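(* Let $i\in\{1,2\}$. Let $\mathcal{R}^o$ be the closure of $\bigcup_{Z\in\mathcal{P}^*}\mathcal{R}^o(Z)$ and $\mathcal{R}_i^r$ the closure of $\bigcup_{Z\in\mathcal{P}^*}\mathcal{R}_i^r(Z)$. If $$I(Y_p;X_i|WQ)\le I(Y_s;X_i|UWQ)\quad\text{for all }Z=QUWX_1X_2X_sY_pY_s\in\mathcal{P}^*,$$ then $\mathcal{R}^o\subseteq\mathcal{R}_i^r$.
   Context: $\mathcal{X}_1,\mathcal{X}_2,\mathcal{X}_s,\mathcal{Y}_p,\mathcal{Y}_s$ are finite sets and $\omega(y_py_s|x_1x_2x_s)$ is a channel (conditional probability distribution) from $\mathcal{X}_1\times\mathcal{X}_2\times\mathcal{X}_s$ to $\mathcal{Y}_p\times\mathcal{Y}_s$. $\mathcal{P}^*$ is the set of all tuples of random variables $Z=QUWX_1X_2X_sY_pY_s$, with $Q,U,W$ taking values in some finite sets and $X_a\in\mathcal{X}_a$, $Y_b\in\mathcal{Y}_b$, such that: $X_1,X_2,U,W$ are conditionally independent given $Q$; $X_s=f(UW|Q)$, i.e. $X_s$ is a deterministic function of $(U,W)$ for each value of $Q$; and given $(Q,U,W,X_1,X_2,X_s)$ the pair $(Y_p,Y_s)$ has conditional law $\omega(\cdot|X_1X_2X_s)$. For a tuple $(R_1,R_2,S,T)$ of nonnegative reals consider $$(P)\quad\begin{aligned}&R_1\le I(Y_p;X_1|WX_2Q),\ R_2\le I(Y_p;X_2|WX_1Q),\ T\le I(Y_p;W|X_1X_2Q),\\&R_1+R_2\le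 I(Y_p;X_1X_2|WQ),\ R_1+T\le I(Y_p;WX_1|X_2Q),\ R_2+T\le I(Y_p;WX_2|X_1Q),\\&R_1+R_2+T\le I(Y_p;WX_1X_2|Q).\end{aligned}$$ $\mathcal{R}^o(Z)$ is the set of pairs $(R_s,R_p)=(S+T,R_1+R_2)$ with $(R_1,R_2,S,T)$ nonnegative satisfying (P) and $S\le I(Y_s;U|WQ)$, $T\le I(Y_s;W|UQ)$, $S+T\le I(Y_s;UW|Q)$. $\mathcal{R}_i^r(Z)$ is the set of pairs $(R_s,R_p)=(S+T,R_1+R_2)$ with $(R_1,R_2,S,T)$ nonnegative satisfying (P) and $$S\le I(Y_s;U|WX_iQ),\ T\le I(Y_s;W|UX_iQ),\ R_i\le I(Y_s;X_i|UWQ),\ S+T\le I(Y_s;UW|X_iQ),$$ $$R_i+S\le I(Y_s;UX_i|WQ),\ R_i+T\le I(Y_s;WX_i|UQ),\ R_i+S+T\le I(Y_s;UWX_i|Q).$$ *)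

theory Defs
  imports "HOL-Probability.Probability"
begin

text \<open>A tuple \<open>Q U W X\<^sub>1 X\<^sub>2 X\<^sub>s Y\<^sub>p Y\<^sub>s\<close> of random variables is represented by its joint law,
  a probability mass function on the type of outcomes below; the random variables are the selectors.
  The auxiliary variables \<open>Q\<close>, \<open>U\<close>, \<open>W\<close> range over arbitrary finite sets; up to relabelling these
  are finite sets of natural numbers (see \<open>pstar\<close>, which requires the supports to be finite).\<close>

datatype ('x1, 'x2, 'xs, 'yp, 'ys) outcome =
  Outcome (Q: nat) (U: nat) (W: nat) (X1: 'x1) (X2: 'x2) (Xs: 'xs) (Yp: 'yp) (Ys: 'ys)

type_synonym ('x1, 'x2, 'xs, 'yp, 'ys) channel = "'x1 \<times> 'x2 \<times> 'xs \<Rightarrow> ('yp \<times> 'ys) pmf"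

abbreviation joint_rv :: "('z \<Rightarrow> 'a) \<Rightarrow> ('z \<Rightarrow> 'b) \<Rightarrow> 'z \<Rightarrow> 'a \<times> 'b"  (infixr "\<diamondop>" 90) where
  "A \<diamondop> B \<equiv> (\<lambda>z. (A z, B z))"

text \<open>Conditional mutual information \<open>I(A; B | C)\<close> in bits. All random variables used here take
  values in countable types, so the discrete sigma-algebras are the appropriate ones.\<close>

definition cmi :: "'z pmf \<Rightarrow> ('z \<Rightarrow> 'a) \<Rightarrow> ('z \<Rightarrow> 'b) \<Rightarrow> ('z \<Rightarrow> 'c) \<Rightarrow> real"
    ("\<I>\<^bsub>_\<^esub>'(_ ; _ | _')" [0, 90, 90, 90] 1000) where
  "\<I>\<^bsub>Z\<^esub>(A ; B | C) =
     prob_space.conditional_mutual_information (measure_pmf Z) 2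
       (count_space UNIV) (count_space UNIV) (count_space UNIV) A B C"

text \<open>\<open>cond_law Z C c A\<close> is the law of \<open>A\<close> given \<open>C = c\<close>; it is meaningful only if \<open>C = c\<close> has
  positive probability.\<close>

definition cond_law :: "'z pmf \<Rightarrow> ('z \<Rightarrow> 'c) \<Rightarrow> 'c \<Rightarrow> ('z \<Rightarrow> 'a) \<Rightarrow> 'a pmf" where
  "cond_law Z C c A = map_pmf A (cond_pmf Z {z. C z = c})"

definition cond_indep4 ::
    "'z pmf \<Rightarrow> ('z \<Rightarrow> 'a) \<Rightarrow> ('z \<Rightarrow> 'b) \<Rightarrow> ('z \<Rightarrow> 'c) \<Rightarrow> ('z \<Rightarrow> 'd) \<Rightarrow> ('z \<Rightarrow> 'e) \<Rightarrow> bool" where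
  "cond_indep4 Z A B C D E \<longleftrightarrow>
     (\<forall>e \<in> E ` set_pmf Z.
        cond_law Z E e (A \<diamondop> B \<diamondop> C \<diamondop> D) =
          pair_pmf (cond_law Z E e A)
            (pair_pmf (cond_law Z E e B) (pair_pmf (cond_law Z E e C) (cond_law Z E e D))))"

definition pstar ::
    "('x1::finite, 'x2::finite, 'xs::finite, 'yp::finite, 'ys::finite) channel
      \<Rightarrow> ('x1, 'x2, 'xs, 'yp, 'ys) outcome pmf set" where
  "pstar \<omega> =
     {Z. finite (Q ` set_pmf Z) \<and> finite (U ` set_pmf Z) \<and> finite (W ` set_pmf Z)
       \<and> cond_indep4 Z X1 X2 U W Q
       \<and> (\<exists>f. \<forall>z \<in> set_pmf Z. Xs z = f (Q z) (U z) (W z))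
       \<and> (\<forall>(q, u, w, x1, x2, xs) \<in> (Q \<diamondop> U \<diamondop> W \<diamondop> X1 \<diamondop> X2 \<diamondop> Xs) ` set_pmf Z.
            cond_law Z (Q \<diamondop> U \<diamondop> W \<diamondop> X1 \<diamondop> X2 \<diamondop> Xs) (q, u, w, x1, x2, xs) (Yp \<diamondop> Ys)
              = \<omega> (x1, x2, xs))}"

definition primary_constraints ::
    "('x1::finite, 'x2::finite, 'xs::finite, 'yp::finite, 'ys::finite) outcome pmf
      \<Rightarrow> real \<Rightarrow> real \<Rightarrow> real \<Rightarrow> bool" where
  "primary_constraints Z R1 R2 T \<longleftrightarrow>
     R1 \<le> \<I>\<^bsub>Z\<^esub>(Yp ; X1 | W \<diamondop> X2 \<diamondop> Q) \<and>
     R2 \<le> \<I>\<^bsub>Z\<^esub>(Yp ; X2 | W \<diamondop> X1 \<diamondop> Q) \<and>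
     T \<le> \<I>\<^bsub>Z\<^esub>(Yp ; W | X1 \<diamondop> X2 \<diamondop> Q) \<and>
     R1 + R2 \<le> \<I>\<^bsub>Z\<^esub>(Yp ; X1 \<diamondop> X2 | W \<diamondop> Q) \<and>
     R1 + T \<le> \<I>\<^bsub>Z\<^esub>(Yp ; W \<diamondop> X1 | X2 \<diamondop> Q) \<and>
     R2 + T \<le> \<I>\<^bsub>Z\<^esub>(Yp ; W \<diamondop> X2 | X1 \<diamondop> Q) \<and>
     R1 + R2 + T \<le> \<I>\<^bsub>Z\<^esub>(Yp ; W \<diamondop> X1 \<diamondop> X2 | Q)"

definition secondary_constraints_o ::
    "('x1::finite, 'x2::finite, 'xs::finite, 'yp::finite, 'ys::finite) outcome pmf
      \<Rightarrow> real \<Rightarrow> real \<Rightarrow> bool" where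
  "secondary_constraints_o Z S T \<longleftrightarrow>
     S \<le> \<I>\<^bsub>Z\<^esub>(Ys ; U | W \<diamondop> Q) \<and>
     T \<le> \<I>\<^bsub>Z\<^esub>(Ys ; W | U \<diamondop> Q) \<and>
     S + T \<le> \<I>\<^bsub>Z\<^esub>(Ys ; U \<diamondop> W | Q)"

text \<open>Here \<open>Xi\<close> is the input of the user with rate \<open>Ri\<close>; it is a parameter because \<open>X1\<close> and \<open>X2\<close>
  have different types.\<close>

definition secondary_constraints_r ::
    "('x1::finite, 'x2::finite, 'xs::finite, 'yp::finite, 'ys::finite) outcome pmf
      \<Rightarrow> (('x1, 'x2, 'xs, 'yp, 'ys) outcome \<Rightarrow> 'xi::finite) \<Rightarrow> real \<Rightarrow> real \<Rightarrow> real \<Rightarrow> bool" where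
  "secondary_constraints_r Z Xi Ri S T \<longleftrightarrow>
     S \<le> \<I>\<^bsub>Z\<^esub>(Ys ; U | W \<diamondop> Xi \<diamondop> Q) \<and>
     T \<le> \<I>\<^bsub>Z\<^esub>(Ys ; W | U \<diamondop> Xi \<diamondop> Q) \<and>
     Ri \<le> \<I>\<^bsub>Z\<^esub>(Ys ; Xi | U \<diamondop> W \<diamondop> Q) \<and>
     S + T \<le> \<I>\<^bsub>Z\<^esub>(Ys ; U \<diamondop> W | Xi \<diamondop> Q) \<and>
     Ri + S \<le> \<I>\<^bsub>Z\<^esub>(Ys ; U \<diamondop> Xi | W \<diamondop> Q) \<and>
     Ri + T \<le> \<I>\<^bsub>Z\<^esub>(Ys ; W \<diamondop> Xi | U \<diamondop> Q) \<and>
     Ri + S + T \<le> \<I>\<^bsub>Z\<^esub>(Ys ; U \<diamondop> W \<diamondop> Xi | Q)"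

definition rates_o ::
    "('x1::finite, 'x2::finite, 'xs::finite, 'yp::finite, 'ys::finite) outcome pmf
      \<Rightarrow> (real \<times> real) set" where
  "rates_o Z =
     {(S + T, R1 + R2) | R1 R2 S T.
        0 \<le> R1 \<and> 0 \<le> R2 \<and> 0 \<le> S \<and> 0 \<le> T
        \<and> primary_constraints Z R1 R2 T \<and> secondary_constraints_o Z S T}"

text \<open>The index \<open>i\<close> is meant to be 1 or 2.\<close>

definition rates_r ::
    "nat \<Rightarrow> ('x1::finite, 'x2::finite, 'xs::finite, 'yp::finite, 'ys::finite) outcome pmf
      \<Rightarrow> (real \<times> real) set" where
  "rates_r i Z =
     {(S + T, R1 + R2) | R1 R2 S T.
        0 \<le> R1 \<and> 0 \<le> R2 \<and> 0 \<le> S \<and> 0 \<le> T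
        \<and> primary_constraints Z R1 R2 T
        \<and> (if i = 1 then secondary_constraints_r Z X1 R1 S T
           else secondary_constraints_r Z X2 R2 S T)}"

definition region_o ::
    "('x1::finite, 'x2::finite, 'xs::finite, 'yp::finite, 'ys::finite) channel
      \<Rightarrow> (real \<times> real) set" where
  "region_o \<omega> = closure (\<Union>Z \<in> pstar \<omega>. rates_o Z)"

definition region_r ::
    "nat \<Rightarrow> ('x1::finite, 'x2::finite, 'xs::finite, 'yp::finite, 'ys::finite) channel
      \<Rightarrow> (real \<times> real) set" where
  "region_r i \<omega> = closure (\<Union>Z \<in> pstar \<omega>. rates_r i Z)"

end

theory Submission imports Defs begin

text \<open>Every constraint is preserved for the same law \<open>Z\<close> after a change of the primary rates
  only. If \<open>R\<^sub>i\<close> exceeds \<open>a = I(Y\<^sub>p; X\<^sub>i | W Q)\<close>, it is lowered to \<open>a\<close> and the excess is moved to the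
  rate of the other primary user. Since \<open>X\<^sub>i\<close> and \<open>W\<close> are independent given \<open>Q\<close>,
  \<open>I(Y\<^sub>p; X\<^sub>i | Q) \<le> a\<close>, and the chain rule turns the sum-rate bounds of (P) into the bounds for the
  enlarged rate. The new \<open>R\<^sub>i\<close> is at most \<open>I(Y\<^sub>s; X\<^sub>i | U W Q)\<close>, which is what the chain rule adds
  to each secondary bound when \<open>X\<^sub>i\<close> is decoded as well.\<close>

section \<open>Entropy of discrete random variables with finite support\<close>

text \<open>Shannon entropy in bits, written as an expectation over outcomes instead of a sum over
  values. Identities between entropies can then be checked pointwise on the support of
  \<open>Z\<close>.\<close>

definition rv_entropy :: "'z pmf \<Rightarrow> ('z \<Rightarrow> 'a) \<Rightarrow> real" where
  "rv_entropy Z A = - measure_pmf.expectation Z (\<lambda>z. log 2 (pmf (map_pmf A Z) (A z)))"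

text \<open>The integrand at \<open>z\<close> is the logarithm of the mass of the fibre of
  \<open>A\<close> through \<open>z\<close>, so only the partition into fibres matters. All later
  reorderings and regroupings of tuples rest on this.\<close>

lemma rv_entropy_cong:
  assumes "\<And>z z'. A z = A z' \<longleftrightarrow> B z = B z'"
  shows "rv_entropy Z A = rv_entropy Z B"
proof -
  have "A -` {A z} = B -` {B z}" for z
    using assms by auto
  then show ?thesis
    by (simp add: rv_entropy_def pmf_map)
qed

lemma information_space_pmf: "information_space (measure_pmf Z) 2"
  by unfold_locales auto

lemma distributed_pmf:
  "distributed (measure_pmf Z) (count_space UNIV) A (pmf (map_pmf A Z))"
  using map_pmf_rep_eq[of A Z] by (simp add: distributed_def measure_pmf_eq_density[of "map_pmf A Z"])

lemma integral_count_space_pmf: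
  fixes g :: "'a \<Rightarrow> real"
  shows "(\<integral>x. pmf p x * g x \<partial>count_space UNIV) = measure_pmf.expectation p g"
  by (simp add: measure_pmf_eq_density integral_density)

lemma integrable_count_space_pmf:
  fixes g :: "'a \<Rightarrow> real"
  assumes "finite (set_pmf p)"
  shows "integrable (count_space UNIV) (\<lambda>x. pmf p x * g x)"
  using integrable_measure_pmf_finite[OF assms, of g]
  by (simp add: measure_pmf_eq_density integrable_density)

lemma pmf_map_pos: "z \<in> set_pmf Z \<Longrightarrow> 0 < pmf (map_pmf A Z) (A z)"
  by (simp add: pmf_positive)

lemma mutual_information_pmf:
  fixes A :: "'z \<Rightarrow> 'a::countable" and B :: "'z \<Rightarrow> 'b::countable"
  assumes "finite (set_pmf Z)"
  shows "prob_space.mutual_information (measure_pmf Z) 2 (count_space UNIV) (count_space UNIV) A B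
    = rv_entropy Z A + rv_entropy Z B - rv_entropy Z (A \<diamondop> B)"
proof -
  interpret information_space "measure_pmf Z" 2 by (rule information_space_pmf)
  have sf: "sigma_finite_measure (count_space (UNIV :: 'a set))"
    "sigma_finite_measure (count_space (UNIV :: 'b set))"
    by (rule sigma_finite_measure_count_space)+
  \<comment> \<open>Countability of the value types enters here: the product of the two counting
    measures is again a counting measure, so the joint pmf serves as a density.\<close>
  have cs: "count_space (UNIV :: 'a set) \<Otimes>\<^sub>M count_space (UNIV :: 'b set) = count_space UNIV"
    by (simp add: pair_measure_countable)
  let ?p = "pmf (map_pmf A Z)" and ?q = "pmf (map_pmf B Z)" and ?r = "pmf (map_pmf (A \<diamondop> B) Z)"
  have "prob_space.mutual_information (measure_pmf Z) 2 (count_space UNIV) (count_space UNIV) A B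
    = (\<integral>x. ?r x * log 2 (?r x / (?p (fst x) * ?q (snd x))) \<partial>count_space UNIV)"
    by (subst mutual_information_distr[OF sf distributed_pmf _ distributed_pmf])
      (auto simp: cs intro: distributed_pmf)
  also have "\<dots> = measure_pmf.expectation Z
      (\<lambda>z. log 2 (?r (A z, B z) / (?p (A z) * ?q (B z))))"
    by (simp add: integral_count_space_pmf)
  \<comment> \<open>On the support of \<open>Z\<close> all three masses are positive, so the
    logarithm of the quotient splits.\<close>
  also have "\<dots> = measure_pmf.expectation Z
      (\<lambda>z. log 2 (?r (A z, B z)) - log 2 (?p (A z)) - log 2 (?q (B z)))"
  proof (intro integral_cong_AE, simp_all add: AE_measure_pmf_iff, intro ballI)
    fix z assume z: "z \<in> set_pmf Z"
    show "log 2 (?r (A z, B z) / (?p (A z) * ?q (B z)))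
      = log 2 (?r (A z, B z)) - log 2 (?p (A z)) - log 2 (?q (B z))"
      using pmf_map_pos[OF z, of A] pmf_map_pos[OF z, of B] pmf_map_pos[OF z, of "A \<diamondop> B"]
      by (simp add: log_divide log_mult)
  qed
  also have "\<dots> = rv_entropy Z A + rv_entropy Z B - rv_entropy Z (A \<diamondop> B)"
    using assms by (simp add: rv_entropy_def integrable_measure_pmf_finite)
  finally show ?thesis .
qed

section \<open>Conditional mutual information\<close>

text \<open>The underlying definition is I(A; (B, C)) - I(A; C), and the two entropies of
  \<open>A\<close> alone cancel. From here on, identities for \<open>cmi\<close> reduce to linear
  arithmetic in entropies.\<close>

lemma cmi_eq_entropies:
  fixes A :: "'z \<Rightarrow> 'a::countable" and B :: "'z \<Rightarrow> 'b::countable" and C :: "'z \<Rightarrow> 'c::countable"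
  assumes "finite (set_pmf Z)"
  shows "\<I>\<^bsub>Z\<^esub>(A ; B | C)
    = rv_entropy Z (A \<diamondop> C) + rv_entropy Z (B \<diamondop> C) - rv_entropy Z (A \<diamondop> B \<diamondop> C) - rv_entropy Z C"
proof -
  have cs: "count_space (UNIV :: 'b set) \<Otimes>\<^sub>M count_space (UNIV :: 'c set) = count_space UNIV"
    by (simp add: pair_measure_countable)
  show ?thesis
    by (simp add: cmi_def prob_space.conditional_mutual_information_def[OF prob_space_measure_pmf] cs
        mutual_information_pmf[OF assms])
qed

lemma cmi_nonneg:
  fixes A :: "'z \<Rightarrow> 'a::countable" and B :: "'z \<Rightarrow> 'b::countable" and C :: "'z \<Rightarrow> 'c::countable"
  assumes "finite (set_pmf Z)"
  shows "0 \<le> \<I>\<^bsub>Z\<^esub>(A ; B | C)"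
proof -
  interpret information_space "measure_pmf Z" 2 by (rule information_space_pmf)
  have cs: "count_space (UNIV :: 'b set) \<Otimes>\<^sub>M count_space (UNIV :: 'c set) = count_space UNIV"
    "count_space (UNIV :: 'a set) \<Otimes>\<^sub>M count_space (UNIV :: 'c set) = count_space UNIV"
    "count_space (UNIV :: 'a set) \<Otimes>\<^sub>M count_space (UNIV :: ('b \<times> 'c) set) = count_space UNIV"
    by (simp_all add: pair_measure_countable)
  let ?pa = "pmf (map_pmf A Z)" and ?pc = "pmf (map_pmf C Z)"
  let ?pbc = "pmf (map_pmf (B \<diamondop> C) Z)" and ?pac = "pmf (map_pmf (A \<diamondop> C) Z)"
  let ?pabc = "pmf (map_pmf (A \<diamondop> B \<diamondop> C) Z)"
  \<comment> \<open>The general nonnegativity theorem asks for integrability of two logarithmic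
    terms, which finite support supplies.\<close>
  have fin: "finite (set_pmf (map_pmf (A \<diamondop> B \<diamondop> C) Z))"
    using assms by simp
  note int = integrable_count_space_pmf[OF fin]
  show ?thesis
    unfolding cmi_def
  proof (rule conditional_mutual_information_generic_nonneg[where Px = ?pa and Pz = ?pc
        and Pyz = ?pbc and Pxz = ?pac and Pxyz = ?pabc])
    show "integrable (count_space UNIV \<Otimes>\<^sub>M count_space UNIV \<Otimes>\<^sub>M count_space UNIV)
        (\<lambda>(x, y, z). ?pabc (x, y, z) * log 2 (?pabc (x, y, z) / (?pa x * ?pbc (y, z))))"
      using int[of "\<lambda>(x, y, z). log 2 (?pabc (x, y, z) / (?pa x * ?pbc (y, z)))"]
      by (simp add: cs split_beta')
    show "integrable (count_space UNIV \<Otimes>\<^sub>M count_space UNIV \<Otimes>\<^sub>M count_space UNIV)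
        (\<lambda>(x, y, z). ?pabc (x, y, z) * log 2 (?pac (x, z) / (?pa x * ?pc z)))"
      using int[of "\<lambda>(x, y, z). log 2 (?pac (x, z) / (?pa x * ?pc z))"]
      by (simp add: cs split_beta')
  qed (simp_all add: cs distributed_pmf sigma_finite_measure_count_space)
qed

lemma cmi_cong:
  fixes A :: "'z \<Rightarrow> 'a::countable" and B :: "'z \<Rightarrow> 'b::countable" and C :: "'z \<Rightarrow> 'c::countable"
    and B' :: "'z \<Rightarrow> 'd::countable" and C' :: "'z \<Rightarrow> 'e::countable"
  assumes "finite (set_pmf Z)"
    and B: "\<And>z z'. B z = B z' \<longleftrightarrow> B' z = B' z'" and C: "\<And>z z'. C z = C z' \<longleftrightarrow> C' z = C' z'"
  shows "\<I>\<^bsub>Z\<^esub>(A ; B | C) = \<I>\<^bsub>Z\<^esub>(A ; B' | C')"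
proof -
  have "rv_entropy Z (A \<diamondop> C) = rv_entropy Z (A \<diamondop> C')"
    "rv_entropy Z (B \<diamondop> C) = rv_entropy Z (B' \<diamondop> C')"
    "rv_entropy Z (A \<diamondop> B \<diamondop> C) = rv_entropy Z (A \<diamondop> B' \<diamondop> C')"
    "rv_entropy Z C = rv_entropy Z C'"
    by (rule rv_entropy_cong, simp add: B C)+
  then show ?thesis
    by (simp add: cmi_eq_entropies[OF assms(1)])
qed

lemma cmi_commute:
  fixes A :: "'z \<Rightarrow> 'a::countable" and B :: "'z \<Rightarrow> 'b::countable" and C :: "'z \<Rightarrow> 'c::countable"
  assumes "finite (set_pmf Z)"
  shows "\<I>\<^bsub>Z\<^esub>(A ; B | C) = \<I>\<^bsub>Z\<^esub>(B ; A | C)"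
proof -
  have "rv_entropy Z (A \<diamondop> B \<diamondop> C) = rv_entropy Z (B \<diamondop> A \<diamondop> C)"
    by (rule rv_entropy_cong) auto
  then show ?thesis
    by (simp add: cmi_eq_entropies[OF assms])
qed

text \<open>In the next three lemmas \<open>D\<close> and \<open>E\<close> are arbitrary relabellings of pairs, so that they
  apply to tuples in any order.\<close>

lemma cmi_chain_rule:
  fixes Y :: "'z \<Rightarrow> 'y::countable" and A :: "'z \<Rightarrow> 'a::countable" and B :: "'z \<Rightarrow> 'b::countable"
    and C :: "'z \<Rightarrow> 'c::countable" and D :: "'z \<Rightarrow> 'd::countable" and E :: "'z \<Rightarrow> 'e::countable"
  assumes "finite (set_pmf Z)"
    and D: "\<And>z z'. D z = D z' \<longleftrightarrow> A z = A z' \<and> B z = B z'"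
    and E: "\<And>z z'. E z = E z' \<longleftrightarrow> A z = A z' \<and> C z = C z'"
  shows "\<I>\<^bsub>Z\<^esub>(Y ; D | C) = \<I>\<^bsub>Z\<^esub>(Y ; A | C) + \<I>\<^bsub>Z\<^esub>(Y ; B | E)"
proof -
  \<comment> \<open>After these identifications the entropies of \<open>E\<close> and of
    \<open>Y\<close> with \<open>E\<close> occur with opposite signs on the right-hand side and
    cancel.\<close>
  have "rv_entropy Z (D \<diamondop> C) = rv_entropy Z (B \<diamondop> E)"
    "rv_entropy Z (Y \<diamondop> D \<diamondop> C) = rv_entropy Z (Y \<diamondop> B \<diamondop> E)"
    "rv_entropy Z (A \<diamondop> C) = rv_entropy Z E"
    "rv_entropy Z (Y \<diamondop> A \<diamondop> C) = rv_entropy Z (Y \<diamondop> E)"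
    by (rule rv_entropy_cong, auto simp: D E)+
  then show ?thesis
    by (simp add: cmi_eq_entropies[OF assms(1)])
qed

lemma cmi_eq_0_chain:
  fixes Y :: "'z \<Rightarrow> 'y::countable" and A :: "'z \<Rightarrow> 'a::countable" and B :: "'z \<Rightarrow> 'b::countable"
    and C :: "'z \<Rightarrow> 'c::countable" and D :: "'z \<Rightarrow> 'd::countable" and E :: "'z \<Rightarrow> 'e::countable"
  assumes "finite (set_pmf Z)"
    and "\<I>\<^bsub>Z\<^esub>(Y ; D | C) = 0"
    and "\<And>z z'. D z = D z' \<longleftrightarrow> A z = A z' \<and> B z = B z'"
    and "\<And>z z'. E z = E z' \<longleftrightarrow> A z = A z' \<and> C z = C z'"
  shows "\<I>\<^bsub>Z\<^esub>(Y ; A | C) = 0" and "\<I>\<^bsub>Z\<^esub>(Y ; B | E) = 0"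
proof -
  have "\<I>\<^bsub>Z\<^esub>(Y ; D | C) = \<I>\<^bsub>Z\<^esub>(Y ; A | C) + \<I>\<^bsub>Z\<^esub>(Y ; B | E)"
    by (rule cmi_chain_rule) fact+
  then show "\<I>\<^bsub>Z\<^esub>(Y ; A | C) = 0" "\<I>\<^bsub>Z\<^esub>(Y ; B | E) = 0"
    using assms(2) cmi_nonneg[OF assms(1), of Y A C] cmi_nonneg[OF assms(1), of Y B E]
    by linarith+
qed

lemma cmi_le_if_cond_indep:
  fixes Y :: "'z \<Rightarrow> 'y::countable" and A :: "'z \<Rightarrow> 'a::countable" and B :: "'z \<Rightarrow> 'b::countable"
    and C :: "'z \<Rightarrow> 'c::countable" and E :: "'z \<Rightarrow> 'e::countable"
  assumes "finite (set_pmf Z)"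
    and 0: "\<I>\<^bsub>Z\<^esub>(A ; B | C) = 0"
    and E: "\<And>z z'. E z = E z' \<longleftrightarrow> B z = B z' \<and> C z = C z'"
  shows "\<I>\<^bsub>Z\<^esub>(Y ; A | C) \<le> \<I>\<^bsub>Z\<^esub>(Y ; A | E)"
proof -
  note fin = assms(1)
  \<comment> \<open>Expand the information of \<open>A\<close> about the pair of \<open>Y\<close>
    and \<open>B\<close> in both orders. The term of \<open>A\<close> and \<open>B\<close> vanishes
    in one expansion, and a nonnegative term is dropped from the other.\<close>
  have "\<I>\<^bsub>Z\<^esub>(A ; Y \<diamondop> B | C) = \<I>\<^bsub>Z\<^esub>(A ; B | C) + \<I>\<^bsub>Z\<^esub>(A ; Y | E)"
    by (rule cmi_chain_rule[OF fin]) (auto simp: E)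
  moreover have "\<I>\<^bsub>Z\<^esub>(A ; Y \<diamondop> B | C) = \<I>\<^bsub>Z\<^esub>(A ; Y | C) + \<I>\<^bsub>Z\<^esub>(A ; B | Y \<diamondop> C)"
    by (rule cmi_chain_rule[OF fin]) auto
  ultimately show ?thesis
    using 0 cmi_nonneg[OF fin, of A B "Y \<diamondop> C"] cmi_commute[OF fin, of Y A C]
      cmi_commute[OF fin, of Y A E] by simp
qed

section \<open>Conditional independence\<close>

lemma pmf_cond_law:
  assumes "e \<in> E ` set_pmf Z"
  shows "pmf (cond_law Z E e A) a = pmf (map_pmf (A \<diamondop> E) Z) (a, e) / pmf (map_pmf E Z) e"
proof -
  have ne: "set_pmf Z \<inter> {z. E z = e} \<noteq> {}"
    using assms by auto
  have "pmf (cond_law Z E e A) a = measure (cond_pmf Z {z. E z = e}) (A -` {a})"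
    by (simp add: cond_law_def pmf_map)
  also have "\<dots> = measure Z ({z. E z = e} \<inter> A -` {a}) / measure Z {z. E z = e}"
    by (simp add: cond_pmf.rep_eq[OF ne] measure_uniform_measure measure_pmf.emeasure_eq_measure
        measure_measure_pmf_not_zero[OF ne])
  finally show ?thesis
    by (simp add: pmf_map vimage_def Int_def conj_commute)
qed

text \<open>Independence given \<open>C\<close> means p(a,b,c) p(c) = p(a,c) p(b,c) on the support.
  Taking logarithms and expectations makes the four entropies cancel.\<close>

lemma cmi_eq_0_if_cond_indep:
  fixes A :: "'z \<Rightarrow> 'a::countable" and B :: "'z \<Rightarrow> 'b::countable" and C :: "'z \<Rightarrow> 'c::countable"
  assumes "finite (set_pmf Z)"
    and indep: "\<And>c. c \<in> C ` set_pmf Z \<Longrightarrow>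
      cond_law Z C c (A \<diamondop> B) = pair_pmf (cond_law Z C c A) (cond_law Z C c B)"
  shows "\<I>\<^bsub>Z\<^esub>(A ; B | C) = 0"
proof -
  note int = integrable_measure_pmf_finite[OF assms(1)]
  let ?l = "\<lambda>F z. log 2 (pmf (map_pmf F Z) (F z))"
  have eq: "?l (A \<diamondop> B \<diamondop> C) z + ?l C z = ?l (A \<diamondop> C) z + ?l (B \<diamondop> C) z" if z: "z \<in> set_pmf Z" for z
  proof -
    have c: "C z \<in> C ` set_pmf Z"
      using z by simp
    have pos: "0 < pmf (map_pmf C Z) (C z)" "0 < pmf (map_pmf (A \<diamondop> C) Z) (A z, C z)"
      "0 < pmf (map_pmf (B \<diamondop> C) Z) (B z, C z)"
      "0 < pmf (map_pmf (A \<diamondop> B \<diamondop> C) Z) (A z, B z, C z)"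
      using pmf_map_pos[OF z, of C] pmf_map_pos[OF z, of "A \<diamondop> C"] pmf_map_pos[OF z, of "B \<diamondop> C"]
        pmf_map_pos[OF z, of "A \<diamondop> B \<diamondop> C"] by auto
    have "pmf (cond_law Z C (C z) (A \<diamondop> B)) (A z, B z)
      = pmf (cond_law Z C (C z) A) (A z) * pmf (cond_law Z C (C z) B) (B z)"
      by (simp add: indep[OF c] pmf_pair)
    moreover have "pmf (map_pmf ((A \<diamondop> B) \<diamondop> C) Z) ((A z, B z), C z)
      = pmf (map_pmf (A \<diamondop> B \<diamondop> C) Z) (A z, B z, C z)"
      by (simp add: pmf_map vimage_def)
    ultimately have "pmf (map_pmf (A \<diamondop> B \<diamondop> C) Z) (A z, B z, C z) * pmf (map_pmf C Z) (C z)
      = pmf (map_pmf (A \<diamondop> C) Z) (A z, C z) * pmf (map_pmf (B \<diamondop> C) Z) (B z, C z)"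
      using pos by (simp add: pmf_cond_law[OF c] field_simps)
    from arg_cong[OF this, of "log 2"] show ?thesis
      using pos by (simp add: log_mult)
  qed
  have "measure_pmf.expectation Z (\<lambda>z. ?l (A \<diamondop> B \<diamondop> C) z + ?l C z)
    = measure_pmf.expectation Z (\<lambda>z. ?l (A \<diamondop> C) z + ?l (B \<diamondop> C) z)"
    using eq by (intro integral_cong_AE) (simp_all add: AE_measure_pmf_iff)
  then show ?thesis
    by (simp add: cmi_eq_entropies[OF assms(1)] rv_entropy_def int)
qed

lemma map_pmf_cond_law: "map_pmf g (cond_law Z E e A) = cond_law Z E e (\<lambda>z. g (A z))"
  by (simp add: cond_law_def map_pmf_comp)

text \<open>Marginalise the fourfold product law. The last two variables stay grouped, since later
  \<open>U\<close> and \<open>W\<close> must be jointly independent of a primary input.\<close>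

lemma cond_indep4_law:
  assumes "cond_indep4 Z A B C D E" "e \<in> E ` set_pmf Z"
  shows "cond_law Z E e (A \<diamondop> C \<diamondop> D) = pair_pmf (cond_law Z E e A) (cond_law Z E e (C \<diamondop> D))"
    and "cond_law Z E e (B \<diamondop> C \<diamondop> D) = pair_pmf (cond_law Z E e B) (cond_law Z E e (C \<diamondop> D))"
proof -
  let ?L = "\<lambda>F. cond_law Z E e F"
  have all: "?L (A \<diamondop> B \<diamondop> C \<diamondop> D) = pair_pmf (?L A) (pair_pmf (?L B) (pair_pmf (?L C) (?L D)))"
    using assms unfolding cond_indep4_def by blast
  from arg_cong[OF all, of "map_pmf snd"]
  have BCD: "?L (B \<diamondop> C \<diamondop> D) = pair_pmf (?L B) (pair_pmf (?L C) (?L D))"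
    by (simp add: map_pmf_cond_law map_snd_pair_pmf)
  from arg_cong[OF this, of "map_pmf snd"]
  have CD: "?L (C \<diamondop> D) = pair_pmf (?L C) (?L D)"
    by (simp add: map_pmf_cond_law map_snd_pair_pmf)
  show "?L (B \<diamondop> C \<diamondop> D) = pair_pmf (?L B) (?L (C \<diamondop> D))"
    by (simp add: BCD CD)
  \<comment> \<open>This projection forgets \<open>B\<close>, the second of the four
    variables.\<close>
  from arg_cong[OF all, of "map_pmf (\<lambda>(a, y). (a, snd y))"]
  show "?L (A \<diamondop> C \<diamondop> D) = pair_pmf (?L A) (?L (C \<diamondop> D))"
    using map_pair[of "\<lambda>a. a" snd "?L A" "pair_pmf (?L B) (pair_pmf (?L C) (?L D))"]
    by (simp add: map_pmf_cond_law map_snd_pair_pmf CD)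
qed

section \<open>Finite support and independence for laws in \<open>pstar\<close>\<close>

lemma finite_set_pmf_pstar:
  fixes Z :: "('x1::finite, 'x2::finite, 'xs::finite, 'yp::finite, 'ys::finite) outcome pmf"
  assumes "Z \<in> pstar \<omega>"
  shows "finite (set_pmf Z)"
proof (rule finite_imageD)
  \<comment> \<open>An outcome is determined by its eight selectors. The three natural-number ones
    have finite range by \<open>pstar\<close>, the others take values in finite types.\<close>
  let ?F = "Q \<diamondop> U \<diamondop> W \<diamondop> X1 \<diamondop> X2 \<diamondop> Xs \<diamondop> Yp \<diamondop> Ys"
  have "?F ` set_pmf Z \<subseteq> Q ` set_pmf Z \<times> U ` set_pmf Z \<times> W ` set_pmf Z \<times> UNIV"
    by auto
  moreover have "finite (Q ` set_pmf Z)" "finite (U ` set_pmf Z)" "finite (W ` set_pmf Z)"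
    using assms unfolding pstar_def by auto
  ultimately show "finite (?F ` set_pmf Z)"
    by (meson finite_SigmaI finite_code finite_subset)
  show "inj_on ?F (set_pmf Z)"
    by (auto intro!: inj_onI outcome.expand)
qed

lemma pstar_cmi_eq_0:
  assumes "Z \<in> pstar \<omega>"
  shows "\<I>\<^bsub>Z\<^esub>(X1 ; U \<diamondop> W | Q) = 0" "\<I>\<^bsub>Z\<^esub>(X2 ; U \<diamondop> W | Q) = 0"
proof -
  have "cond_indep4 Z X1 X2 U W Q"
    using assms by (simp add: pstar_def)
  note * = cond_indep4_law[OF this]
  show "\<I>\<^bsub>Z\<^esub>(X1 ; U \<diamondop> W | Q) = 0"
    by (rule cmi_eq_0_if_cond_indep[OF finite_set_pmf_pstar[OF assms]]) (rule *(1))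
  show "\<I>\<^bsub>Z\<^esub>(X2 ; U \<diamondop> W | Q) = 0"
    by (rule cmi_eq_0_if_cond_indep[OF finite_set_pmf_pstar[OF assms]]) (rule *(2))
qed

section \<open>Moving the excess rate to the other primary user\<close>

text \<open>The rate of user j becomes \<open>Ri + Rj - a\<close>. Only its two bounds without
  \<open>Ri\<close> can be endangered by the move: every other bound of (P) involves the unchanged
  sum, \<open>T\<close> alone, or the lowered rate of user i. The variables are generic so that both
  users can take the role of \<open>Xi\<close>; \<open>V\<close> and \<open>R\<close> stand for
  \<open>W\<close> and \<open>Q\<close>.\<close>

lemma primary_constraints_shift:
  fixes Xi :: "'z \<Rightarrow> 'xi::countable" and Xj :: "'z \<Rightarrow> 'xj::countable" and Y :: "'z \<Rightarrow> 'y::countable"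
    and V :: "'z \<Rightarrow> 'v::countable" and R :: "'z \<Rightarrow> 'r::countable"
  assumes fin: "finite (set_pmf Z)"
    and indep: "\<I>\<^bsub>Z\<^esub>(Xi ; V | R) = 0"
    and c: "Ri + Rj \<le> \<I>\<^bsub>Z\<^esub>(Y ; Xi \<diamondop> Xj | V \<diamondop> R)"
      "Ri + Rj + T \<le> \<I>\<^bsub>Z\<^esub>(Y ; V \<diamondop> Xi \<diamondop> Xj | R)"
    and a: "a = \<I>\<^bsub>Z\<^esub>(Y ; Xi | V \<diamondop> R)"
  shows "Ri + Rj - a \<le> \<I>\<^bsub>Z\<^esub>(Y ; Xj | V \<diamondop> Xi \<diamondop> R)"
    and "Ri + Rj - a + T \<le> \<I>\<^bsub>Z\<^esub>(Y ; V \<diamondop> Xj | Xi \<diamondop> R)"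
proof -
  have "\<I>\<^bsub>Z\<^esub>(Y ; Xi \<diamondop> Xj | V \<diamondop> R) = a + \<I>\<^bsub>Z\<^esub>(Y ; Xj | V \<diamondop> Xi \<diamondop> R)"
    unfolding a by (rule cmi_chain_rule[OF fin]) auto
  with c(1) show "Ri + Rj - a \<le> \<I>\<^bsub>Z\<^esub>(Y ; Xj | V \<diamondop> Xi \<diamondop> R)"
    by linarith
  have "\<I>\<^bsub>Z\<^esub>(Y ; V \<diamondop> Xi \<diamondop> Xj | R) = \<I>\<^bsub>Z\<^esub>(Y ; Xi | R) + \<I>\<^bsub>Z\<^esub>(Y ; V \<diamondop> Xj | Xi \<diamondop> R)"
    by (rule cmi_chain_rule[OF fin]) auto
  moreover have "\<I>\<^bsub>Z\<^esub>(Y ; Xi | R) \<le> a"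
    unfolding a by (rule cmi_le_if_cond_indep[OF fin indep]) auto
  ultimately show "Ri + Rj - a + T \<le> \<I>\<^bsub>Z\<^esub>(Y ; V \<diamondop> Xj | Xi \<diamondop> R)"
    using c(2) by linarith
qed

text \<open>Bounds without \<open>Ri\<close> only get weaker, because conditioning on an input
  independent of \<open>U\<close> and \<open>W\<close> does not decrease the information about them.
  Bounds with \<open>Ri\<close> are sums of a bound from \<open>secondary_constraints_o\<close> and
  the bound on \<open>Ri\<close>.\<close>

lemma secondary_constraints_r_if_o:
  fixes Z :: "('x1::finite, 'x2::finite, 'xs::finite, 'yp::finite, 'ys::finite) outcome pmf"
  assumes fin: "finite (set_pmf Z)"
    and indep: "\<I>\<^bsub>Z\<^esub>(Xi ; U \<diamondop> W | Q) = 0"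
    and o: "secondary_constraints_o Z S T"
    and Ri: "Ri \<le> \<I>\<^bsub>Z\<^esub>(Ys ; Xi | U \<diamondop> W \<diamondop> Q)"
  shows "secondary_constraints_r Z Xi Ri S T"
proof -
  \<comment> \<open>Joint independence allows either auxiliary variable to be moved into the
    conditioning.\<close>
  have "\<I>\<^bsub>Z\<^esub>(Xi ; U | W \<diamondop> Q) = 0" "\<I>\<^bsub>Z\<^esub>(Xi ; W | U \<diamondop> Q) = 0"
    by (rule cmi_eq_0_chain(2)[OF fin indep]; auto)+
  then have zero: "\<I>\<^bsub>Z\<^esub>(U ; Xi | W \<diamondop> Q) = 0" "\<I>\<^bsub>Z\<^esub>(W ; Xi | U \<diamondop> Q) = 0"
    "\<I>\<^bsub>Z\<^esub>(U \<diamondop> W ; Xi | Q) = 0"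
    using indep by (simp_all add: cmi_commute[OF fin, where B = Xi])
  have mono: "\<I>\<^bsub>Z\<^esub>(Ys ; U | W \<diamondop> Q) \<le> \<I>\<^bsub>Z\<^esub>(Ys ; U | W \<diamondop> Xi \<diamondop> Q)"
    "\<I>\<^bsub>Z\<^esub>(Ys ; W | U \<diamondop> Q) \<le> \<I>\<^bsub>Z\<^esub>(Ys ; W | U \<diamondop> Xi \<diamondop> Q)"
    "\<I>\<^bsub>Z\<^esub>(Ys ; U \<diamondop> W | Q) \<le> \<I>\<^bsub>Z\<^esub>(Ys ; U \<diamondop> W | Xi \<diamondop> Q)"
    by (rule cmi_le_if_cond_indep[OF fin], rule zero, auto)+
  have chain:
    "\<I>\<^bsub>Z\<^esub>(Ys ; U \<diamondop> Xi | W \<diamondop> Q) = \<I>\<^bsub>Z\<^esub>(Ys ; U | W \<diamondop> Q) + \<I>\<^bsub>Z\<^esub>(Ys ; Xi | U \<diamondop> W \<diamondop> Q)"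
    "\<I>\<^bsub>Z\<^esub>(Ys ; W \<diamondop> Xi | U \<diamondop> Q) = \<I>\<^bsub>Z\<^esub>(Ys ; W | U \<diamondop> Q) + \<I>\<^bsub>Z\<^esub>(Ys ; Xi | U \<diamondop> W \<diamondop> Q)"
    "\<I>\<^bsub>Z\<^esub>(Ys ; U \<diamondop> W \<diamondop> Xi | Q) = \<I>\<^bsub>Z\<^esub>(Ys ; U \<diamondop> W | Q) + \<I>\<^bsub>Z\<^esub>(Ys ; Xi | U \<diamondop> W \<diamondop> Q)"
    by (rule cmi_chain_rule[OF fin]; auto)+
  show ?thesis
    using o Ri mono unfolding secondary_constraints_o_def secondary_constraints_r_def chain
    by linarith
qed

section \<open>Inclusion of the rate sets for one law, then of the closures\<close>

lemma rates_o_subset_rates_r: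
  assumes Z: "Z \<in> pstar \<omega>"
    and le: "if i = 1 then \<I>\<^bsub>Z\<^esub>(Yp ; X1 | W \<diamondop> Q) \<le> \<I>\<^bsub>Z\<^esub>(Ys ; X1 | U \<diamondop> W \<diamondop> Q)
      else \<I>\<^bsub>Z\<^esub>(Yp ; X2 | W \<diamondop> Q) \<le> \<I>\<^bsub>Z\<^esub>(Ys ; X2 | U \<diamondop> W \<diamondop> Q)"
  shows "rates_o Z \<subseteq> rates_r i Z"
proof (rule subsetI)
  fix r assume "r \<in> rates_o Z"
  then obtain R1 R2 S T where r: "r = (S + T, R1 + R2)"
    and nn: "0 \<le> R1" "0 \<le> R2" "0 \<le> S" "0 \<le> T"
    and p: "primary_constraints Z R1 R2 T" and s: "secondary_constraints_o Z S T"
    unfolding rates_o_def by blast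
  note fin = finite_set_pmf_pstar[OF Z]
  have indep_W: "\<I>\<^bsub>Z\<^esub>(X1 ; W | Q) = 0" "\<I>\<^bsub>Z\<^esub>(X2 ; W | Q) = 0"
    by (rule cmi_eq_0_chain(1)[OF fin pstar_cmi_eq_0(1)[OF Z], where B = U and E = "W \<diamondop> Q"]; auto)
      (rule cmi_eq_0_chain(1)[OF fin pstar_cmi_eq_0(2)[OF Z], where B = U and E = "W \<diamondop> Q"]; auto)
  show "r \<in> rates_r i Z"
  proof (cases "i = 1")
    case True
    define a where "a = \<I>\<^bsub>Z\<^esub>(Yp ; X1 | W \<diamondop> Q)"
    have a: "0 \<le> a" "a \<le> \<I>\<^bsub>Z\<^esub>(Ys ; X1 | U \<diamondop> W \<diamondop> Q)"
      using le True cmi_nonneg[OF fin] by (auto simp: a_def)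
    have shift: "R1 + R2 - a \<le> \<I>\<^bsub>Z\<^esub>(Yp ; X2 | W \<diamondop> X1 \<diamondop> Q)"
      "R1 + R2 - a + T \<le> \<I>\<^bsub>Z\<^esub>(Yp ; W \<diamondop> X2 | X1 \<diamondop> Q)"
      using p unfolding primary_constraints_def
      by (auto intro!: primary_constraints_shift[OF fin _ _ _ a_def] indep_W)
    \<comment> \<open>The minimum covers both cases: if \<open>R1\<close> is at most
      \<open>a\<close>, the rates stay as they are; otherwise the excess goes to user 2.\<close>
    define R1' where "R1' = min R1 a"
    define R2' where "R2' = R1 + R2 - R1'"
    have "primary_constraints Z R1' R2' T"
      using p shift unfolding primary_constraints_def R2'_def R1'_def min_def
      by (simp split: if_splits)
    moreover have "secondary_constraints_r Z X1 R1' S T"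
      using a by (intro secondary_constraints_r_if_o[OF fin] pstar_cmi_eq_0[OF Z] s)
        (simp add: R1'_def)
    moreover have "0 \<le> R1'" "0 \<le> R2'" "r = (S + T, R1' + R2')"
      using nn a r by (auto simp: R1'_def R2'_def)
    ultimately show ?thesis
      using True nn unfolding rates_r_def by auto
  next
    case False
    define a where "a = \<I>\<^bsub>Z\<^esub>(Yp ; X2 | W \<diamondop> Q)"
    have a: "0 \<le> a" "a \<le> \<I>\<^bsub>Z\<^esub>(Ys ; X2 | U \<diamondop> W \<diamondop> Q)"
      using le False cmi_nonneg[OF fin] by (auto simp: a_def)
    \<comment> \<open>The bounds of (P) list \<open>X1\<close> first, while
      \<open>primary_constraints_shift\<close> expects the user whose rate is lowered, here
      \<open>X2\<close>, in that place.\<close>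
    have swap: "\<I>\<^bsub>Z\<^esub>(Yp ; X1 \<diamondop> X2 | W \<diamondop> Q) = \<I>\<^bsub>Z\<^esub>(Yp ; X2 \<diamondop> X1 | W \<diamondop> Q)"
      "\<I>\<^bsub>Z\<^esub>(Yp ; W \<diamondop> X1 \<diamondop> X2 | Q) = \<I>\<^bsub>Z\<^esub>(Yp ; W \<diamondop> X2 \<diamondop> X1 | Q)"
      by (rule cmi_cong[OF fin]; auto)+
    have shift: "R2 + R1 - a \<le> \<I>\<^bsub>Z\<^esub>(Yp ; X1 | W \<diamondop> X2 \<diamondop> Q)"
      "R2 + R1 - a + T \<le> \<I>\<^bsub>Z\<^esub>(Yp ; W \<diamondop> X1 | X2 \<diamondop> Q)"
      using p unfolding primary_constraints_def swap
      by (auto intro!: primary_constraints_shift[OF fin _ _ _ a_def] indep_W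
          simp: add.commute[of R2 R1])
    define R2' where "R2' = min R2 a"
    define R1' where "R1' = R1 + R2 - R2'"
    have "primary_constraints Z R1' R2' T"
      using p shift unfolding primary_constraints_def R1'_def R2'_def min_def
      by (simp split: if_splits)
    moreover have "secondary_constraints_r Z X2 R2' S T"
      using a by (intro secondary_constraints_r_if_o[OF fin] pstar_cmi_eq_0[OF Z] s)
        (simp add: R2'_def)
    moreover have "0 \<le> R1'" "0 \<le> R2'" "r = (S + T, R1' + R2')"
      using nn a r by (auto simp: R1'_def R2'_def)
    ultimately show ?thesis
      using False nn unfolding rates_r_def by auto
  qed
qed

theorem corollary5:
  fixes \<omega> :: "('x1::finite, 'x2::finite, 'xs::finite, 'yp::finite, 'ys::finite) channel"
    and i :: nat
  assumes "i \<in> {1, 2}"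
    and "\<And>Z. Z \<in> pstar \<omega> \<Longrightarrow>
           (if i = 1 then \<I>\<^bsub>Z\<^esub>(Yp ; X1 | W \<diamondop> Q) \<le> \<I>\<^bsub>Z\<^esub>(Ys ; X1 | U \<diamondop> W \<diamondop> Q)
            else \<I>\<^bsub>Z\<^esub>(Yp ; X2 | W \<diamondop> Q) \<le> \<I>\<^bsub>Z\<^esub>(Ys ; X2 | U \<diamondop> W \<diamondop> Q))"
  shows "region_o \<omega> \<subseteq> region_r i \<omega>"
  unfolding region_o_def region_r_def
  using rates_o_subset_rates_r[OF _ assms(2)] by (intro closure_mono UN_mono) auto

end
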